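(* Let $f:(0,\infty)\to\mathbb{R}$ be a convex function that is strictly convex at $1$ and satisfies $f(1)=0$. Then the $f$-divergence between univariate Cauchy distributions is symmetric, i.e. $I_f(p_\lambda:p_{\lambda'})=I_f(p_{\lambda'}:p_\lambda)$ for all $\lambda=(l,s)$ and $\lambda'=(l',s')$ in $\mathbb{R}\times(0,\infty)$, and there exists a function $h_f:[0,\infty)\to[0,\infty)$ with $h_f(0)=0$ such that for all such $\lambda,\lambda'$ $$I_f(p_\lambda:p_{\lambda'})=h_f(\chi(\lambda,\lambda')),\qquad \chi(\lambda,\lambda'):=\frac{\|\lambda-\lambda'\|^2}{2\lambda_2\lambda_2'}=\frac{(l-l')^2+(s-s')^2}{2ss'}.$$
   Context: For $\lambda=(\lambda_1,\lambda_2)=(l,s)\in\mathbb{R}\times(0,\infty)$, the Cauchy density is $p_\lambda(x)=p_{l,s}(x)=\frac{s}{\pi(s^2+(x-l)^2)}$, $x\in\mathbb{R}$. For strictly positive probability densities $p,q$ on $\mathbb{R}$, the $f$-divergence is $I_f(p:q):=\int_{\mathbb{R}}p(x)\,f\!\left(\frac{q(x)}{p(x)}\right)dx$. $\|\cdot\|$ is the Euclidean norm on $\mathbb{R}^2$. *)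

theory Defs
  imports "HOL-Analysis.Analysis"
begin

(* A parameter lam = (l, s) is a point of the plane real \<times> real, whose library norm is the
   Euclidean one.  The parameter space is UNIV \<times> {0<..}. *)

definition cauchy_density :: "real \<times> real \<Rightarrow> real \<Rightarrow> real" where
  "cauchy_density lam x = snd lam / (pi * ((snd lam)\<^sup>2 + (x - fst lam)\<^sup>2))"

definition f_div_integrand ::
    "(real \<Rightarrow> real) \<Rightarrow> (real \<Rightarrow> real) \<Rightarrow> (real \<Rightarrow> real) \<Rightarrow> real \<Rightarrow> real" where
  "f_div_integrand f p q x = p x * f (q x / p x)"

(* Meaningful when p, q are strictly positive densities with integrable integrand: the Bochner
   integral of a non-integrable function is 0 by convention. *)
definition f_divergence ::
    "(real \<Rightarrow> real) \<Rightarrow> (real \<Rightarrow> real) \<Rightarrow> (real \<Rightarrow> real) \<Rightarrow> real" where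
  "f_divergence f p q = (LINT x|lborel. f_div_integrand f p q x)"

(* Pointwise notion: Jensen's inequality is strict for every nontrivial convex combination
   that is equal to c. *)
definition strictly_convex_at :: "real set \<Rightarrow> (real \<Rightarrow> real) \<Rightarrow> real \<Rightarrow> bool" where
  "strictly_convex_at S f c \<longleftrightarrow>
     (\<forall>x\<in>S. \<forall>y\<in>S. \<forall>t\<in>{0<..<1}. x \<noteq> y \<longrightarrow> (1 - t) * x + t * y = c \<longrightarrow>
        f c < (1 - t) * f x + t * f y)"

definition cauchy_chi :: "real \<times> real \<Rightarrow> real \<times> real \<Rightarrow> real" where
  "cauchy_chi lam lam' = (norm (lam - lam'))\<^sup>2 / (2 * snd lam * snd lam')"

lemma cauchy_chi_Pair:
  "cauchy_chi (l, s) (l', s') = ((l - l')\<^sup>2 + (s - s')\<^sup>2) / (2 * s * s')"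
  by (simp add: cauchy_chi_def norm_Pair)

end

theory Submission
  imports Defs
begin

text \<open>Substituting \<open>x = l + s tan t\<close> turns \<open>p\<^sub>\<lambda>(x) dx\<close> into \<open>dt / \<pi>\<close> on \<open>(-\<pi>/2, \<pi>/2)\<close>, and the
  likelihood ratio into \<open>1 / (a + r cos (2 t + \<phi>))\<close> with \<open>a = 1 + \<chi>\<close> and \<open>r = sqrt (a\<^sup>2 - 1)\<close>. By periodicity
  the phase \<open>\<phi>\<close> does not affect the integral, so the divergence depends on \<open>\<chi>\<close> alone, which is
  symmetric. Nonnegativity is Jensen's inequality, via a supporting line of \<open>f\<close> at \<open>1\<close>.\<close>

text \<open>The part of the shifted window beyond \<open>a + T\<close> is, by periodicity, a copy of
  the part \<open>{a..a + c}\<close> lost on the left. The bounds on \<open>c\<close> keep the cut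
  \<open>a + c\<close> inside the window.\<close>

lemma integral_periodic_shift:
  fixes G :: "real \<Rightarrow> real"
  assumes cont: "continuous_on UNIV G" and per: "\<And>x. G (x + T) = G x" and c: "0 \<le> c" "c \<le> T"
  shows "integral {a..a + T} (\<lambda>x. G (x + c)) = integral {a..a + T} G"
proof -
  have int: "G integrable_on {u..v}" for u v
    using cont continuous_on_subset integrable_continuous_real by blast
  have "integral {a..a + T} (\<lambda>x. G (x + c)) = integral {a + c..a + T + c} G"
    using integral_shift_Icc_real[of a "a + T" G c] by (simp add: o_def add.commute)
  also have "\<dots> = integral {a + c..a + T} G + integral {a + T..a + T + c} G"
    using c by (intro Henstock_Kurzweil_Integration.integral_combine[symmetric] int) auto
  also have "integral {a + T..a + T + c} G = integral {a..a + c} G"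
    using integral_shift_Icc_real[of a "a + c" G T] per
    by (simp add: o_def add.commute add.left_commute)
  also have "integral {a + c..a + T} G + integral {a..a + c} G = integral {a..a + T} G"
    using c Henstock_Kurzweil_Integration.integral_combine[of a "a + c" "a + T" G] int by simp
  finally show ?thesis .
qed

text \<open>The range of \<phi> is recorded because \<open>\<phi> / 2\<close> later serves as a
  shift that must lie between 0 and the period \<open>pi\<close>.\<close>

lemma polar_coordinates:
  fixes x y :: real
  obtains \<phi> where "0 \<le> \<phi>" "\<phi> < 2 * pi"
    "x = sqrt (x\<^sup>2 + y\<^sup>2) * cos \<phi>" "y = sqrt (x\<^sup>2 + y\<^sup>2) * sin \<phi>"
proof (cases "x\<^sup>2 + y\<^sup>2 = 0")
  case True
  then show ?thesis using that[of 0] by (simp add: sum_power2_eq_zero_iff)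
next
  case False
  let ?r = "sqrt (x\<^sup>2 + y\<^sup>2)"
  have r: "?r \<noteq> 0" using False by simp
  have "(x / ?r)\<^sup>2 + (y / ?r)\<^sup>2 = 1"
    using False by (simp add: power_divide add_divide_distrib[symmetric])
  then obtain \<phi> where "0 \<le> \<phi>" "\<phi> < 2 * pi" "x / ?r = cos \<phi>" "y / ?r = sin \<phi>"
    by (rule sincos_total_2pi)
  with r show ?thesis using that[of \<phi>] by (metis nonzero_mult_div_cancel_left times_divide_eq_right)
qed

text \<open>The amplitude is smaller than \<open>a\<close>. This keeps the reciprocal, the future
  argument of \<open>f\<close>, inside \<open>{0<..}\<close>.\<close>

lemma add_sqrt_cos_pos:
  fixes a :: real
  assumes "a \<ge> 1"
  shows "0 < a + sqrt (a\<^sup>2 - 1) * cos u"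
proof -
  have "sqrt (a\<^sup>2 - 1) < a" using assms by (intro real_less_lsqrt) auto
  moreover have "sqrt (a\<^sup>2 - 1) * cos u \<ge> sqrt (a\<^sup>2 - 1) * (-1)"
    using assms by (intro mult_left_mono) auto
  ultimately show ?thesis by simp
qed

text \<open>The interval has length \<open>pi\<close>, one full period of
  \<open>cos (2 * t)\<close>, so this is an average over the circle in the angle
  \<open>2 * t\<close>.\<close>

definition circle_mean :: "(real \<Rightarrow> real) \<Rightarrow> real \<Rightarrow> real" where
  "circle_mean f a =
     integral {-(pi/2)..pi/2} (\<lambda>t. f (1 / (a + sqrt (a\<^sup>2 - 1) * cos (2 * t)))) / pi"

lemma tan_affine_image:
  fixes l s :: real
  assumes "s > 0"
  shows "(\<lambda>t. l + s * tan t) ` {-(pi/2)<..<pi/2} = UNIV"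
proof -
  have "x \<in> (\<lambda>t. l + s * tan t) ` {-(pi/2)<..<pi/2}" for x
    using assms arctan[of "(x - l) / s"] by (intro image_eqI[of _ _ "arctan ((x - l) / s)"]) auto
  then show ?thesis by auto
qed

lemma tan_affine_inj:
  fixes l s :: real
  assumes "s > 0"
  shows "inj_on (\<lambda>t. l + s * tan t) {-(pi/2)<..<pi/2}"
  using assms by (intro inj_on_inverseI[of _ "\<lambda>x. arctan ((x - l) / s)"]) (simp add: arctan_tan)

lemma sec_affine:
  fixes s :: real
  assumes "cos t \<noteq> 0"
  shows "s\<^sup>2 + (s * tan t)\<^sup>2 = s\<^sup>2 / (cos t)\<^sup>2"
proof -
  have "s\<^sup>2 + (s * tan t)\<^sup>2 = s\<^sup>2 * (1 + (tan t)\<^sup>2)"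
    by (simp add: power_mult_distrib algebra_simps)
  then show ?thesis
    using assms by (simp add: tan_sec divide_inverse power_inverse)
qed

lemma cauchy_density_pos: "s > 0 \<Longrightarrow> 0 < cauchy_density (l, s) x"
  by (simp add: cauchy_density_def sum_power2_gt_zero_iff add_pos_nonneg)

lemma continuous_on_cauchy_density: "s > 0 \<Longrightarrow> continuous_on UNIV (cauchy_density (l, s))"
  unfolding cauchy_density_def
  by (intro continuous_intros) (auto simp: add_pos_nonneg less_imp_neq[symmetric])

text \<open>After multiplication by \<open>(cos t)\<^sup>2\<close>, the inverse ratio is a quadratic
  form in \<open>cos t\<close> and \<open>sin t\<close>, hence a constant plus a pure oscillation in
  \<open>2 * t\<close>. The form has determinant 1 and half-trace \<open>a\<close>, which forces the
  amplitude \<open>sqrt (a\<^sup>2 - 1)\<close>.\<close>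

lemma cauchy_ratio_tan:
  assumes s: "s > 0" "s' > 0"
  obtains \<phi> where "0 \<le> \<phi>" "\<phi> < 2 * pi"
    "\<And>t. cos t \<noteq> 0 \<Longrightarrow>
       cauchy_density (l', s') (l + s * tan t) / cauchy_density (l, s) (l + s * tan t) =
       1 / (1 + cauchy_chi (l, s) (l', s') +
            sqrt ((1 + cauchy_chi (l, s) (l', s'))\<^sup>2 - 1) * cos (2 * t + \<phi>))"
proof -
  define d where "d = l - l'"
  define a where "a = 1 + cauchy_chi (l, s) (l', s')"
  have a: "a = (d\<^sup>2 + s\<^sup>2 + s'\<^sup>2) / (2 * s * s')"
    using s by (simp add: a_def cauchy_chi_Pair d_def field_simps power2_eq_square)
  \<comment> \<open>\<open>x\<close> and \<open>- y\<close> are the coefficients of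
    \<open>cos (2 * t)\<close> and \<open>sin (2 * t)\<close> in the inverse ratio.\<close>
  define x where "x = (d\<^sup>2 + s'\<^sup>2 - s\<^sup>2) / (2 * s * s')"
  define y where "y = - d / s'"
  have r: "x\<^sup>2 + y\<^sup>2 = a\<^sup>2 - 1"
    using s by (simp add: a x_def y_def divide_simps) algebra
  obtain \<phi> where \<phi>: "0 \<le> \<phi>" "\<phi> < 2 * pi" "x = sqrt (a\<^sup>2 - 1) * cos \<phi>" "y = sqrt (a\<^sup>2 - 1) * sin \<phi>"
    using polar_coordinates[of x y] unfolding r by metis
  have "cauchy_density (l', s') (l + s * tan t) / cauchy_density (l, s) (l + s * tan t) =
       1 / (a + sqrt (a\<^sup>2 - 1) * cos (2 * t + \<phi>))" if t: "cos t \<noteq> 0" for t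
  proof -
    define X where "X = s'\<^sup>2 + (d + s * tan t)\<^sup>2"
    have "sqrt (a\<^sup>2 - 1) * cos (2 * t + \<phi>) = x * cos (2 * t) - y * sin (2 * t)"
      using \<phi> by (simp add: cos_add algebra_simps)
    also have "a + \<dots> = X * (cos t)\<^sup>2 / (s * s')"
    proof -
      have "(sin t)\<^sup>2 = 1 - (cos t)\<^sup>2" by (simp add: sin_squared_eq)
      then show ?thesis
        using s t by (simp add: X_def a x_def y_def cos_double sin_double tan_def divide_simps) algebra
    qed
    finally have 1: "a + sqrt (a\<^sup>2 - 1) * cos (2 * t + \<phi>) = X * (cos t)\<^sup>2 / (s * s')" .
    have p: "cauchy_density (l, s) (l + s * tan t) = s / (pi * (s\<^sup>2 / (cos t)\<^sup>2))"
      using sec_affine[OF t, of s] by (simp add: cauchy_density_def)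
    have q: "cauchy_density (l', s') (l + s * tan t) = s' / (pi * X)"
      by (simp add: cauchy_density_def X_def d_def algebra_simps)
    show ?thesis
      unfolding 1 p q using s t by (simp add: field_simps power2_eq_square)
  qed
  then show ?thesis using that \<phi> unfolding a_def by blast
qed

text \<open>One change of variables gives both integrability and value. Asking only for continuity
  of \<open>f\<close> lets constant functions in, which later yields the total mass of the
  density.\<close>

lemma cauchy_f_divergence:
  assumes f: "continuous_on {0<..} f" and s: "s > 0" "s' > 0"
  shows integrable_cauchy_integrand:
      "integrable lborel (f_div_integrand f (cauchy_density (l, s)) (cauchy_density (l', s')))"
      (is "integrable lborel ?F")
    and cauchy_f_divergence_eq:
      "f_divergence f (cauchy_density (l, s)) (cauchy_density (l', s')) =
       circle_mean f (1 + cauchy_chi (l, s) (l', s'))"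
proof -
  define a where "a = 1 + cauchy_chi (l, s) (l', s')"
  have a1: "a \<ge> 1" using s by (simp add: a_def cauchy_chi_def)
  define G where "G = (\<lambda>t. f (1 / (a + sqrt (a\<^sup>2 - 1) * cos (2 * t))))"
  have pos: "0 < a + sqrt (a\<^sup>2 - 1) * cos u" for u by (rule add_sqrt_cos_pos[OF a1])
  have contG: "continuous_on UNIV G"
    unfolding G_def
    by (rule continuous_on_compose2[OF f])
      (auto intro!: continuous_intros pos simp: less_imp_neq[OF pos, symmetric])
  obtain \<phi> where \<phi>: "0 \<le> \<phi>" "\<phi> < 2 * pi"
    and ratio: "\<And>t. cos t \<noteq> 0 \<Longrightarrow>
       cauchy_density (l', s') (l + s * tan t) / cauchy_density (l, s) (l + s * tan t) =
       1 / (a + sqrt (a\<^sup>2 - 1) * cos (2 * t + \<phi>))"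
    using cauchy_ratio_tan[OF s] unfolding a_def by metis
  let ?I = "{-(pi/2)<..<pi/2}" and ?g = "\<lambda>t. l + s * tan t"
  let ?H = "\<lambda>t. G (t + \<phi> / 2) / pi"
  have cosI: "cos t \<noteq> 0" if "t \<in> ?I" for t
    using that cos_gt_zero_pi[of t] by auto
  have deriv: "(?g has_field_derivative s / (cos t)\<^sup>2) (at t within ?I)" if "t \<in> ?I" for t
  proof (rule has_field_derivative_at_within)
    show "(?g has_field_derivative s / (cos t)\<^sup>2) (at t)"
      using DERIV_add[OF DERIV_const DERIV_cmult[OF DERIV_tan[OF cosI[OF that]]], of l s]
      by (simp add: divide_inverse)
  qed
  \<comment> \<open>The Jacobian cancels the density up to the uniform weight
    \<open>1 / pi\<close>.\<close>
  have subst: "\<bar>s / (cos t)\<^sup>2\<bar> * ?F (?g t) = ?H t" if "t \<in> ?I" for t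
  proof -
    have c: "cos t \<noteq> 0" using cosI that by blast
    have "s\<^sup>2 + (s * tan t)\<^sup>2 = s\<^sup>2 / (cos t)\<^sup>2"
      by (rule sec_affine[OF c])
    then have "\<bar>s / (cos t)\<^sup>2\<bar> * cauchy_density (l, s) (?g t) = 1 / pi"
      using s c by (simp add: cauchy_density_def power2_eq_square)
    then show ?thesis
      using ratio[OF c] unfolding f_div_integrand_def G_def
      by (simp add: distrib_left mult.assoc[symmetric])
  qed
  have contH: "continuous_on UNIV ?H"
    by (intro continuous_intros continuous_on_compose2[OF contG]) auto
  \<comment> \<open>Compactness of the closed interval gives integrability; the substitution itself
    needs the open one, where \<open>tan\<close> is finite.\<close>
  have "?H absolutely_integrable_on {-(pi/2)..pi/2}"
    using contH continuous_on_subset by (intro absolutely_integrable_continuous_real) blast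
  then have HI: "?H absolutely_integrable_on ?I"
    by (rule set_integrable_subset) auto
  have "integral ?I ?H = integral {-(pi/2)..pi/2} ?H"
    by (simp add: integral_open_interval_real)
  also have "\<dots> = integral {-(pi/2)..-(pi/2) + pi} (\<lambda>t. G (t + \<phi> / 2)) / pi"
    by simp
  also have "integral {-(pi/2)..-(pi/2) + pi} (\<lambda>t. G (t + \<phi> / 2)) = integral {-(pi/2)..-(pi/2) + pi} G"
    by (rule integral_periodic_shift[OF contG]) (use \<phi> in \<open>auto simp: G_def distrib_left\<close>)
  also have "\<dots> / pi = circle_mean f a"
    by (simp add: circle_mean_def G_def)
  finally have val: "integral ?I ?H = circle_mean f a" .
  have "(\<lambda>t. \<bar>s / (cos t)\<^sup>2\<bar> * ?F (?g t)) absolutely_integrable_on ?I"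
    using HI subst set_integrable_cong[of lebesgue lebesgue ?I ?I _ ?H] by simp
  moreover have "integral ?I (\<lambda>t. \<bar>s / (cos t)\<^sup>2\<bar> * ?F (?g t)) = circle_mean f a"
    unfolding val[symmetric]
    by (rule Henstock_Kurzweil_Integration.integral_cong) (rule subst)
  ultimately have F: "?F absolutely_integrable_on ?g ` ?I \<and> integral (?g ` ?I) ?F = circle_mean f a"
    using has_absolute_integral_change_of_variables_1'[of ?I ?g "\<lambda>t. s / (cos t)\<^sup>2" ?F "circle_mean f a"]
      deriv tan_affine_inj[OF s(1)] by auto
  \<comment> \<open>The substitution yields integrability over \<open>lebesgue\<close>; Borel
    measurability transfers it to \<open>lborel\<close>.\<close>
  have meas: "?F \<in> borel_measurable lborel"
  proof -
    have "continuous_on UNIV ?F"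
      unfolding f_div_integrand_def
      using s by (intro continuous_intros continuous_on_compose2[OF f] continuous_on_cauchy_density)
        (auto simp: cauchy_density_pos less_imp_neq[OF cauchy_density_pos, symmetric])
    then show ?thesis by (simp add: borel_measurable_continuous_onI)
  qed
  have *: "integrable lebesgue ?F" "integral UNIV ?F = circle_mean f a"
    using F unfolding tan_affine_image[OF s(1)] by (auto simp: set_integrable_def)
  show int: "integrable lborel ?F"
    using * meas by (simp add: integrable_completion)
  show "f_divergence f (cauchy_density (l, s)) (cauchy_density (l', s')) =
       circle_mean f (1 + cauchy_chi (l, s) (l', s'))"
    using integral_lborel[OF int] * by (simp add: f_divergence_def a_def)
qed

text \<open>For the constant function 1 the divergence integrand is the density itself, and the
  circle mean is 1.\<close>

lemma cauchy_density_integral: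
  assumes "s > 0"
  shows "integrable lborel (cauchy_density (l, s))" "(LINT x|lborel. cauchy_density (l, s) x) = 1"
  using cauchy_f_divergence[of "\<lambda>_. 1" s s l l] assms
  by (simp_all add: f_div_integrand_def[abs_def] f_divergence_def circle_mean_def)

text \<open>A supporting line at 1 bounds the integrand below by \<open>c * (?q x - ?p x)\<close>,
  whose integral vanishes since both densities have mass 1.\<close>

lemma f_divergence_cauchy_nonneg:
  assumes f: "convex_on {0<..} f" "f 1 = 0" and s: "s > 0" "s' > 0"
  shows "0 \<le> f_divergence f (cauchy_density (l, s)) (cauchy_density (l', s'))"
proof -
  let ?p = "cauchy_density (l, s)" and ?q = "cauchy_density (l', s')"
  obtain c where c: "\<And>u. u > 0 \<Longrightarrow> f u \<ge> c * (u - 1)"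
    using convex_le_Inf_differential[OF f(1), of 1] f(2) by (auto simp: interior_open)
  have cont: "continuous_on {0<..} f" using f(1) by (intro convex_on_continuous) auto
  have "0 = (LINT x|lborel. c * (?q x - ?p x))"
    using s by (simp add: cauchy_density_integral)
  also have "\<dots> \<le> f_divergence f ?p ?q"
    unfolding f_divergence_def
  proof (rule integral_mono)
    show "integrable lborel (\<lambda>x. c * (?q x - ?p x))"
      using s by (intro integrable_mult_right Bochner_Integration.integrable_diff cauchy_density_integral)
    show "integrable lborel (f_div_integrand f ?p ?q)"
      by (rule integrable_cauchy_integrand[OF cont s])
    fix x
    have p: "?p x > 0" "?q x > 0" using s by (auto intro: cauchy_density_pos)
    then have "?p x * (c * (?q x / ?p x - 1)) \<le> ?p x * f (?q x / ?p x)"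
      by (intro mult_left_mono c) auto
    moreover have "?p x * (c * (?q x / ?p x - 1)) = c * (?q x - ?p x)"
      using p by (simp add: field_simps)
    ultimately show "c * (?q x - ?p x) \<le> f_div_integrand f ?p ?q x"
      by (simp add: f_div_integrand_def)
  qed
  finally show ?thesis .
qed

theorem theorem1:
  fixes f :: "real \<Rightarrow> real"
  assumes "convex_on {0<..} f"
    and "strictly_convex_at {0<..} f 1"
    and "f 1 = 0"
  shows
    "(\<forall>lam \<in> UNIV \<times> {0<..}. \<forall>lam' \<in> UNIV \<times> {0<..}.
        integrable lborel (f_div_integrand f (cauchy_density lam) (cauchy_density lam'))) \<and>
     (\<forall>lam \<in> UNIV \<times> {0<..}. \<forall>lam' \<in> UNIV \<times> {0<..}.
        f_divergence f (cauchy_density lam) (cauchy_density lam') =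
        f_divergence f (cauchy_density lam') (cauchy_density lam)) \<and>
     (\<exists>h :: real \<Rightarrow> real. h \<in> {0..} \<rightarrow> {0..} \<and> h 0 = 0 \<and>
        (\<forall>lam \<in> UNIV \<times> {0<..}. \<forall>lam' \<in> UNIV \<times> {0<..}.
           f_divergence f (cauchy_density lam) (cauchy_density lam') =
           h (cauchy_chi lam lam')))"
proof -
  have cont: "continuous_on {0<..} f" using assms(1) by (intro convex_on_continuous) auto
  note eq = cauchy_f_divergence_eq[OF cont]
  have sym: "cauchy_chi lam lam' = cauchy_chi lam' lam" for lam lam'
    by (simp add: cauchy_chi_def norm_minus_commute mult_ac)
  have nonneg: "0 \<le> circle_mean f (1 + u)" if "u \<ge> 0" for u
  proof -
    \<comment> \<open>Every \<open>u \<ge> 0\<close> is the value of \<open>cauchy_chi\<close> at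
      some pair, so nonnegativity of the divergence carries over to all of
      \<open>{0..}\<close>.\<close>
    have "cauchy_chi (0, 1) (sqrt (2 * u), 1) = u" using that by (simp add: cauchy_chi_Pair)
    then show ?thesis
      using f_divergence_cauchy_nonneg[OF assms(1,3), of 1 1 0 "sqrt (2 * u)"] eq[of 1 1 0 "sqrt (2 * u)"]
      by simp
  qed
  \<comment> \<open>At \<open>a = 1\<close> the amplitude vanishes and the integrand is constantly
    \<open>f 1\<close>.\<close>
  have zero: "circle_mean f (1 + 0) = 0" by (simp add: circle_mean_def assms(3))
  show ?thesis
    using integrable_cauchy_integrand[OF cont] eq sym nonneg zero
    by (intro conjI exI[of _ "\<lambda>u. circle_mean f (1 + u)"]) auto
qed

end
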